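(* Let the braid group $\mathcal B_3=\langle\beta_{12},\beta_{23}\rangle$ act on triples of matrices $(M_1,M_2,M_3)\in SL_2(\mathbb C)^3$ by $$\beta_{12}(M_1,M_2,M_3)=(M_1M_2M_1^{-1},\,M_1,\,M_3),\qquad \beta_{23}(M_1,M_2,M_3)=(M_1,\,M_2M_3M_2^{-1},\,M_2)$$ (the action describing analytic continuation of solutions of the sixth Painlevé equation). Put $G_{i,j}=-\mathrm{Tr}(M_iM_j)$ for $1\le i<j\le3$, $G_i=-\mathrm{Tr}(M_i)$, $G_\infty=-\mathrm{Tr}(M_1M_2M_3)$, and $\omega_{i,j}=G_iG_j+G_kG_\infty$ for $\{i,j,k\}=\{1,2,3\}$. Then the induced action on these functions is $$\beta_{12}:\quad G_{1,2}\mapsto G_{1,2},\quad G_{2,3}\mapsto G_{1,3},\quad G_{1,3}\mapsto G_{1,2}G_{1,3}-G_{2,3}-\omega_{2,3},$$ $$\omega_{1,2}\mapsto\omega_{1,2},\quad \omega_{2,3}\mapsto\omega_{1,3},\quad \omega_{1,3}\mapsto\omega_{2,3};$$ $$\beta_{23}:\quad G_{1,2}\mapsto G_{2,3}G_{1,2}-G_{1,3}-\omega_{1,3},\quad G_{2,3}\mapsto G_{2,3},\quad G_{1,3}\mapsto G_{1,2},$$ $$\omega_{1,2}\mapsto\omega_{1,3},\quad \omega_{2,3}\mapsto\omega_{2,3},\quad \omega_{1,3}\mapsto\omega_{1,2}.$$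
   Context: The induced action of a transformation $\beta$ of triples on a function $f(M_1,M_2,M_3)$ is $f\mapsto f\circ\beta$, i.e. $f$ evaluated on the new triple, expressed through the functions of the old triple. *)

theory Defs
  imports "HOL-Analysis.Determinants" "HOL-Algebra.Group_Action"
begin

section \<open>The braid group on three strands\<close>

datatype braid_gen = B12 | B23

text \<open>A letter \<open>(s, True)\<close> stands for the generator \<open>s\<close> and \<open>(s, False)\<close> for its inverse.\<close>

type_synonym braid_word = "(braid_gen \<times> bool) list"

inductive braid_equiv :: "braid_word \<Rightarrow> braid_word \<Rightarrow> bool" where
  refl: "braid_equiv u u"
| sym: "braid_equiv u v \<Longrightarrow> braid_equiv v u"
| trans: "braid_equiv u v \<Longrightarrow> braid_equiv v w \<Longrightarrow> braid_equiv u w"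
| cancel: "braid_equiv (u @ [(s, e), (s, \<not> e)] @ v) (u @ v)"
| braid: "braid_equiv (u @ [(B12, True), (B23, True), (B12, True)] @ v)
                      (u @ [(B23, True), (B12, True), (B23, True)] @ v)"

quotient_type braid3 = braid_word / braid_equiv
  by (rule equivpI) (auto intro: reflpI sympI transpI braid_equiv.intros)

lemma braid_equiv_append1: "braid_equiv u v \<Longrightarrow> braid_equiv (u @ w) (v @ w)"
proof (induction rule: braid_equiv.induct)
  case (cancel u s e v)
  then show ?case using braid_equiv.cancel[of u s e "v @ w"] by simp
next
  case (braid u v)
  then show ?case using braid_equiv.braid[of u "v @ w"] by simp
qed (blast intro: braid_equiv.intros)+

lemma braid_equiv_append2: "braid_equiv u v \<Longrightarrow> braid_equiv (w @ u) (w @ v)"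
proof (induction rule: braid_equiv.induct)
  case (cancel u s e v)
  then show ?case using braid_equiv.cancel[of "w @ u" s e v] by simp
next
  case (braid u v)
  then show ?case using braid_equiv.braid[of "w @ u" v] by simp
qed (blast intro: braid_equiv.intros)+

lift_definition braid_mult :: "braid3 \<Rightarrow> braid3 \<Rightarrow> braid3" is "(@)"
  by (meson braid_equiv.trans braid_equiv_append1 braid_equiv_append2)

lift_definition braid_one :: braid3 is "[]" .

lift_definition sigma12 :: braid3 is "[(B12, True)]" .

lift_definition sigma23 :: braid3 is "[(B23, True)]" .

definition braid_group :: "braid3 monoid" where
  "braid_group = \<lparr>carrier = UNIV, mult = braid_mult, one = braid_one\<rparr>"

lemma braid_left_inverse: "\<exists>v. braid_equiv (v @ w) []"
proof (induction w)
  case Nil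
  then show ?case using braid_equiv.refl by force
next
  case (Cons l w)
  obtain s e where l: "l = (s, e)" by force
  from Cons obtain v where v: "braid_equiv (v @ w) []" by blast
  have "braid_equiv ((v @ [(s, \<not> e)]) @ l # w) (v @ w)"
    using braid_equiv.cancel[of v s "\<not> e" w] l by simp
  with v show ?case by (blast intro: braid_equiv.trans)
qed

lemma group_braid_group: "group braid_group"
proof (rule groupI)
  fix x y z :: braid3
  show "x \<otimes>\<^bsub>braid_group\<^esub> y \<otimes>\<^bsub>braid_group\<^esub> z
      = x \<otimes>\<^bsub>braid_group\<^esub> (y \<otimes>\<^bsub>braid_group\<^esub> z)"
    unfolding braid_group_def
    by simp (transfer, simp add: braid_equiv.refl)
  show "\<one>\<^bsub>braid_group\<^esub> \<otimes>\<^bsub>braid_group\<^esub> x = x"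
    unfolding braid_group_def
    by simp (transfer, simp add: braid_equiv.refl)
  have "\<exists>y. braid_mult y x = braid_one"
    by transfer (rule braid_left_inverse)
  then show "\<exists>y\<in>carrier braid_group. y \<otimes>\<^bsub>braid_group\<^esub> x = \<one>\<^bsub>braid_group\<^esub>"
    by (simp add: braid_group_def)
qed (simp_all add: braid_group_def)

lemma braid_group_relation:
  "sigma12 \<otimes>\<^bsub>braid_group\<^esub> sigma23 \<otimes>\<^bsub>braid_group\<^esub> sigma12
   = sigma23 \<otimes>\<^bsub>braid_group\<^esub> sigma12 \<otimes>\<^bsub>braid_group\<^esub> sigma23"
  unfolding braid_group_def
  by simp (transfer, use braid_equiv.braid[of "[]" "[]"] in simp)

context group
begin

definition braid_letter :: "'a \<Rightarrow> 'a \<Rightarrow> braid_gen \<times> bool \<Rightarrow> 'a" where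
  "braid_letter a b l =
     (let g = (case fst l of B12 \<Rightarrow> a | B23 \<Rightarrow> b) in if snd l then g else inv g)"

definition braid_eval :: "'a \<Rightarrow> 'a \<Rightarrow> braid_word \<Rightarrow> 'a" where
  "braid_eval a b w = foldr (\<lambda>l g. braid_letter a b l \<otimes> g) w \<one>"

lemma braid_eval_simps [simp]:
  "braid_eval a b [] = \<one>"
  "braid_eval a b (l # w) = braid_letter a b l \<otimes> braid_eval a b w"
  by (simp_all add: braid_eval_def)

lemma braid_letter_closed [simp]:
  "a \<in> carrier G \<Longrightarrow> b \<in> carrier G \<Longrightarrow> braid_letter a b l \<in> carrier G"
  by (auto simp: braid_letter_def Let_def split: braid_gen.split)

lemma braid_eval_closed [simp]:
  "a \<in> carrier G \<Longrightarrow> b \<in> carrier G \<Longrightarrow> braid_eval a b w \<in> carrier G"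
  by (induction w) auto

lemma braid_eval_append:
  "a \<in> carrier G \<Longrightarrow> b \<in> carrier G \<Longrightarrow>
   braid_eval a b (u @ v) = braid_eval a b u \<otimes> braid_eval a b v"
  by (induction u) (auto simp: m_assoc)

lemma braid_letter_cancel:
  "a \<in> carrier G \<Longrightarrow> b \<in> carrier G \<Longrightarrow>
   braid_letter a b (s, e) \<otimes> braid_letter a b (s, \<not> e) = \<one>"
  by (auto simp: braid_letter_def Let_def split: braid_gen.split)

lemma braid_eval_respects:
  assumes "a \<in> carrier G" "b \<in> carrier G" "a \<otimes> b \<otimes> a = b \<otimes> a \<otimes> b"
  shows "braid_equiv u v \<Longrightarrow> braid_eval a b u = braid_eval a b v"
proof (induction rule: braid_equiv.induct)
  case (cancel u s e v)
  have "braid_eval a b [(s, e), (s, \<not> e)] = \<one>"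
    using assms braid_letter_cancel by simp
  then show ?case using assms by (simp only: braid_eval_append) simp
next
  case (braid u v)
  have "braid_eval a b [(B12, True), (B23, True), (B12, True)]
      = braid_eval a b [(B23, True), (B12, True), (B23, True)]"
    using assms by (simp add: braid_letter_def m_assoc)
  then show ?case using assms by (simp only: braid_eval_append)
qed auto

text \<open>The universal property of the presentation.\<close>

lemma braid_group_universal:
  assumes ab: "a \<in> carrier G" "b \<in> carrier G" "a \<otimes> b \<otimes> a = b \<otimes> a \<otimes> b"
  shows "\<exists>h. group_hom braid_group G h \<and> h sigma12 = a \<and> h sigma23 = b"
proof -
  define h where "h x = braid_eval a b (rep_braid3 x)" for x
  have h_abs: "h (abs_braid3 w) = braid_eval a b w" for w
    unfolding h_def
    by (rule braid_eval_respects[OF ab])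
       (meson Quotient3_braid3 rep_abs_rsp_left braid_equiv.refl)
  have "h (braid_mult x y) = h x \<otimes> h y" for x y
  proof -
    obtain u v where "x = abs_braid3 u" "y = abs_braid3 v"
      by (metis Quotient3_abs_rep Quotient3_braid3)
    then show ?thesis
      using ab by (simp add: braid_mult.abs_eq h_abs braid_eval_append)
  qed
  moreover have "h x \<in> carrier G" for x
    using ab by (simp add: h_def)
  ultimately have "group_hom braid_group G h"
    using group_braid_group is_group
    by (auto simp: group_hom_def group_hom_axioms_def hom_def braid_group_def)
  moreover have "h sigma12 = a" "h sigma23 = b"
    using ab by (simp_all add: sigma12_def sigma23_def h_abs braid_letter_def)
  ultimately show ?thesis by blast
qed

end

section \<open>Triples of matrices and the trace functions\<close>

type_synonym cmat2 = "complex^2^2"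

definition SL2 :: "cmat2 set" where
  "SL2 = {M. det M = 1}"

definition SL2_triples :: "(cmat2 \<times> cmat2 \<times> cmat2) set" where
  "SL2_triples = SL2 \<times> SL2 \<times> SL2"

fun M_entry :: "nat \<Rightarrow> cmat2 \<times> cmat2 \<times> cmat2 \<Rightarrow> cmat2" where
  "M_entry i (M1, M2, M3) = (if i = 1 then M1 else if i = 2 then M2 else M3)"

definition G_single :: "nat \<Rightarrow> cmat2 \<times> cmat2 \<times> cmat2 \<Rightarrow> complex" where
  "G_single i M = - trace (M_entry i M)"

definition G_pair :: "nat \<Rightarrow> nat \<Rightarrow> cmat2 \<times> cmat2 \<times> cmat2 \<Rightarrow> complex" where
  "G_pair i j M = - trace (M_entry i M ** M_entry j M)"

definition G_inf :: "cmat2 \<times> cmat2 \<times> cmat2 \<Rightarrow> complex" where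
  "G_inf M = - trace (M_entry 1 M ** M_entry 2 M ** M_entry 3 M)"

text \<open>For distinct \<open>i, j \<in> {1, 2, 3}\<close> the third index is \<open>6 - i - j\<close>.\<close>

definition \<omega> :: "nat \<Rightarrow> nat \<Rightarrow> cmat2 \<times> cmat2 \<times> cmat2 \<Rightarrow> complex" where
  "\<omega> i j M = G_single i M * G_single j M + G_single (6 - i - j) M * G_inf M"

section \<open>Existence of the braid group action\<close>

lemma SL2_inv:
  assumes "A \<in> SL2"
  shows "A ** matrix_inv A = mat 1" "matrix_inv A ** A = mat 1" "matrix_inv A \<in> SL2"
proof -
  have "invertible A" using assms by (simp add: SL2_def invertible_det_nz)
  then have "A ** matrix_inv A = mat 1 \<and> matrix_inv A ** A = mat 1"
    unfolding invertible_def matrix_inv_def by (rule someI_ex)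
  then show 1: "A ** matrix_inv A = mat 1" and "matrix_inv A ** A = mat 1"
    by simp_all
  have "det A * det (matrix_inv A) = 1"
    using arg_cong[OF 1, of det] by (simp add: det_mul)
  then show "matrix_inv A \<in> SL2" using assms by (simp add: SL2_def)
qed

lemma SL2_mult: "A \<in> SL2 \<Longrightarrow> B \<in> SL2 \<Longrightarrow> A ** B \<in> SL2"
  by (simp add: SL2_def det_mul)

lemma SL2_cancel:
  assumes "A \<in> SL2"
  shows "A ** (matrix_inv A ** B) = B" "matrix_inv A ** (A ** B) = B"
  using SL2_inv[OF assms] by (simp_all add: matrix_mul_assoc)

lemma SL2_inv_conj:
  assumes "A \<in> SL2" "B \<in> SL2"
  shows "matrix_inv (A ** B ** matrix_inv A) = A ** matrix_inv B ** matrix_inv A"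
  (is "matrix_inv ?C = ?D")
proof -
  have C: "?C \<in> SL2" using assms by (simp add: SL2_mult SL2_inv)
  have "?C ** ?D = mat 1"
    using assms by (simp add: matrix_mul_assoc[symmetric] SL2_inv SL2_cancel)
  then have "matrix_inv ?C ** (?C ** ?D) = matrix_inv ?C" by simp
  then show ?thesis by (simp only: SL2_cancel[OF C])
qed

lemma braid_action_exists:
  "\<exists>\<phi>. group_action braid_group SL2_triples \<phi> \<and>
     (\<forall>M1\<in>SL2. \<forall>M2\<in>SL2. \<forall>M3\<in>SL2.
        \<phi> sigma12 (M1, M2, M3) = (M1 ** M2 ** matrix_inv M1, M1, M3) \<and>
        \<phi> sigma23 (M1, M2, M3) = (M1, M2 ** M3 ** matrix_inv M2, M2))"
proof -
  let ?E = SL2_triples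
  let ?H = "BijGroup ?E"
  define a where "a = (\<lambda>(M1, M2, M3) \<in> ?E. (M1 ** M2 ** matrix_inv M1, M1, M3))"
  define b where "b = (\<lambda>(M1, M2, M3) \<in> ?E. (M1, M2 ** M3 ** matrix_inv M2, M2))"
  have a_eq: "a (x, y, z) = (x ** y ** matrix_inv x, x, z)"
    and b_eq: "b (x, y, z) = (x, y ** z ** matrix_inv y, y)"
    if "x \<in> SL2" "y \<in> SL2" "z \<in> SL2" for x y z
    using that by (simp_all add: a_def b_def SL2_triples_def)
  have "bij_betw a ?E ?E"
    by (rule bij_betw_byWitness[where f' = "\<lambda>(p, q, r). (q, matrix_inv q ** p ** q, r)"])
       (auto simp: SL2_triples_def a_eq SL2_mult SL2_inv SL2_cancel matrix_mul_assoc[symmetric])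
  then have a: "a \<in> carrier ?H"
    by (auto simp: BijGroup_def Bij_def a_def)
  have "bij_betw b ?E ?E"
    by (rule bij_betw_byWitness[where f' = "\<lambda>(p, q, r). (p, r, matrix_inv r ** q ** r)"])
       (auto simp: SL2_triples_def b_eq SL2_mult SL2_inv SL2_cancel matrix_mul_assoc[symmetric])
  then have b: "b \<in> carrier ?H"
    by (auto simp: BijGroup_def Bij_def b_def)
  interpret H: group ?H by (rule group_BijGroup)
  have mult: "(f \<otimes>\<^bsub>?H\<^esub> g) = compose ?E f g" if "f \<in> carrier ?H" "g \<in> carrier ?H" for f g
    using that by (simp add: BijGroup_def)
  have "a \<otimes>\<^bsub>?H\<^esub> b \<otimes>\<^bsub>?H\<^esub> a = b \<otimes>\<^bsub>?H\<^esub> a \<otimes>\<^bsub>?H\<^esub> b"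
  proof (rule extensionalityI[where A = ?E])
    fix t assume "t \<in> ?E"
    then obtain x y z where t: "t = (x, y, z)" "x \<in> SL2" "y \<in> SL2" "z \<in> SL2"
      by (auto simp: SL2_triples_def)
    have cl: "x ** y ** matrix_inv x \<in> SL2" "x ** z ** matrix_inv x \<in> SL2"
      "y ** z ** matrix_inv y \<in> SL2"
      using t by (simp_all add: SL2_mult SL2_inv)
    have inE: "(p, q, r) \<in> ?E \<longleftrightarrow> p \<in> SL2 \<and> q \<in> SL2 \<and> r \<in> SL2" for p q r
      by (simp add: SL2_triples_def)
    have "a (b (a t)) = b (a (b t))"
    proof -
      have "x ** y ** matrix_inv x ** (x ** z ** matrix_inv x) ** matrix_inv (x ** y ** matrix_inv x)
          = x ** (y ** z ** matrix_inv y) ** matrix_inv x"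
        unfolding SL2_inv_conj[OF t(2,3)]
        using t by (simp add: matrix_mul_assoc[symmetric] SL2_inv SL2_cancel)
      moreover have "x ** (y ** z ** matrix_inv y) ** matrix_inv x \<in> SL2"
        using t cl by (simp add: SL2_mult SL2_inv)
      ultimately show ?thesis
        using t cl by (simp add: a_eq b_eq)
    qed
    moreover have "f (g s) = (f \<otimes>\<^bsub>?H\<^esub> g) s" if "f \<in> carrier ?H" "g \<in> carrier ?H" "s \<in> ?E" for f g s
      using that by (simp add: mult compose_def)
    moreover have "a t \<in> ?E" "b t \<in> ?E"
      using t cl by (simp_all add: inE a_eq b_eq)
    ultimately show "(a \<otimes>\<^bsub>?H\<^esub> b \<otimes>\<^bsub>?H\<^esub> a) t = (b \<otimes>\<^bsub>?H\<^esub> a \<otimes>\<^bsub>?H\<^esub> b) t"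
      using a b \<open>t \<in> ?E\<close> H.m_closed by metis
  next
    have "f \<in> extensional ?E" if "f \<in> carrier ?H" for f
      using that by (simp add: BijGroup_def Bij_def)
    then show "a \<otimes>\<^bsub>?H\<^esub> b \<otimes>\<^bsub>?H\<^esub> a \<in> extensional ?E"
      "b \<otimes>\<^bsub>?H\<^esub> a \<otimes>\<^bsub>?H\<^esub> b \<in> extensional ?E"
      using a b by simp_all
  qed
  then obtain h where "group_hom braid_group ?H h" "h sigma12 = a" "h sigma23 = b"
    using H.braid_group_universal[OF a b] by blast
  then show ?thesis
    by (intro exI[of _ h]) (auto simp: group_action_def a_eq b_eq)
qed

end

theory Submission
  imports Defs
begin

text \<open>Every trace of a product needed here reduces to the \<open>SL\<^sub>2\<close> skein relation
  \<open>tr (A B) + tr (A\<^sup>-\<^sup>1 B) = tr A tr B\<close>, which comes from the Cayley--Hamilton identity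
  \<open>A\<^sup>-\<^sup>1 = (tr A) 1 - A\<close>, together with the cyclicity of the trace.\<close>

lemma SL2_matrix_inv_eq:
  assumes "A \<in> SL2"
  shows "matrix_inv A = mat (trace A) - A"
proof -
  \<comment> \<open>Cayley-Hamilton with determinant 1, checked entrywise;
    \<open>mat (trace A)\<close> is the scalar matrix.\<close>
  have "A ** (mat (trace A) - A) = mat 1"
    using assms
    by (simp add: SL2_def det_2 vec_eq_iff forall_2 matrix_matrix_mult_def mat_def trace_def
        sum_2 algebra_simps)
  then show ?thesis
    using SL2_cancel(2)[OF assms, of "mat (trace A) - A"] by simp
qed

text \<open>Only the inverted factor must lie in \<open>SL2\<close>, so arbitrary products may be
  put in place of \<open>B\<close>.\<close>

lemma SL2_trace_inv_mult:
  assumes "A \<in> SL2"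
  shows "trace (matrix_inv A ** B) = trace A * trace B - trace (A ** B)"
  by (simp add: SL2_matrix_inv_eq[OF assms] matrix_matrix_mult_def mat_def trace_def sum_2
      algebra_simps)

lemma SL2_trace_conj:
  assumes "A \<in> SL2"
  shows "trace (A ** B ** matrix_inv A) = trace B"
proof -
  have "trace (A ** B ** matrix_inv A) = trace (matrix_inv A ** (A ** B))"
    by (rule trace_mul_sym)
  then show ?thesis by (simp add: SL2_cancel[OF assms])
qed

text \<open>Three skein relations, inverting \<open>A\<close>, then \<open>A ** C\<close>, then
  \<open>C\<close>. Up to sign this is the quadratic image of \<open>G_pair 1 3\<close> under
  \<open>sigma12\<close>: the first two terms on the right form \<open>\<omega> 2 3\<close>.\<close>

lemma SL2_trace_conj_mult:
  assumes A: "A \<in> SL2" and C: "C \<in> SL2"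
  shows "trace (A ** B ** matrix_inv A ** C) =
    trace A * trace (A ** B ** C) + trace B * trace C
    - trace (A ** B) * trace (A ** C) - trace (B ** C)"
proof -
  have "trace (A ** B ** matrix_inv A ** C) = trace (matrix_inv A ** (C ** A ** B))"
    using trace_mul_sym[of "A ** B" "matrix_inv A ** C"] by (simp add: matrix_mul_assoc)
  also have "\<dots> = trace A * trace (A ** B ** C) - trace (A ** (C ** A ** B))"
    using SL2_trace_inv_mult[OF A, of "C ** A ** B"] trace_mul_sym[of "A ** B" C]
    by (simp only: matrix_mul_assoc)
  \<comment> \<open>Since \<open>A\<close> occurs twice, the word is split into two factors that
    both contain it; inverting the first then cancels \<open>A\<close> and leaves
    \<open>matrix_inv C ** B\<close>.\<close>
  also have "trace (A ** (C ** A ** B)) = trace ((A ** C) ** (A ** B))"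
    by (simp add: matrix_mul_assoc)
  also have "\<dots> = trace (A ** C) * trace (A ** B) - trace (matrix_inv (A ** C) ** (A ** B))"
    using SL2_trace_inv_mult[OF SL2_mult[OF A C], of "A ** B"] by simp
  also have "matrix_inv (A ** C) = matrix_inv C ** matrix_inv A"
  proof -
    have "(A ** C) ** (matrix_inv C ** matrix_inv A) = mat 1"
      by (simp add: matrix_mul_assoc[symmetric] SL2_cancel[OF C] SL2_inv[OF A])
    then show ?thesis
      using SL2_cancel(2)[OF SL2_mult[OF A C], of "matrix_inv C ** matrix_inv A"] by simp
  qed
  also have "trace (matrix_inv C ** matrix_inv A ** (A ** B)) = trace C * trace B - trace (B ** C)"
    using trace_mul_sym[of B C]
    by (simp add: matrix_mul_assoc[symmetric] SL2_cancel[OF A] SL2_trace_inv_mult[OF C])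
  finally show ?thesis by (simp add: algebra_simps)
qed

theorem mainTheorem7:
  fixes \<phi> :: "braid3 \<Rightarrow> cmat2 \<times> cmat2 \<times> cmat2 \<Rightarrow> cmat2 \<times> cmat2 \<times> cmat2"
    and M :: "cmat2 \<times> cmat2 \<times> cmat2"
  assumes "group_action braid_group SL2_triples \<phi>"
    and "\<forall>M1\<in>SL2. \<forall>M2\<in>SL2. \<forall>M3\<in>SL2.
           \<phi> sigma12 (M1, M2, M3) = (M1 ** M2 ** matrix_inv M1, M1, M3) \<and>
           \<phi> sigma23 (M1, M2, M3) = (M1, M2 ** M3 ** matrix_inv M2, M2)"
    and "M \<in> SL2_triples"
  shows "(G_pair 1 2 \<circ> \<phi> sigma12) M = G_pair 1 2 M \<and>
         (G_pair 2 3 \<circ> \<phi> sigma12) M = G_pair 1 3 M \<and>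
         (G_pair 1 3 \<circ> \<phi> sigma12) M = G_pair 1 2 M * G_pair 1 3 M - G_pair 2 3 M - \<omega> 2 3 M \<and>
         (\<omega> 1 2 \<circ> \<phi> sigma12) M = \<omega> 1 2 M \<and>
         (\<omega> 2 3 \<circ> \<phi> sigma12) M = \<omega> 1 3 M \<and>
         (\<omega> 1 3 \<circ> \<phi> sigma12) M = \<omega> 2 3 M \<and>
         (G_pair 1 2 \<circ> \<phi> sigma23) M = G_pair 2 3 M * G_pair 1 2 M - G_pair 1 3 M - \<omega> 1 3 M \<and>
         (G_pair 2 3 \<circ> \<phi> sigma23) M = G_pair 2 3 M \<and>
         (G_pair 1 3 \<circ> \<phi> sigma23) M = G_pair 1 2 M \<and>
         (\<omega> 1 2 \<circ> \<phi> sigma23) M = \<omega> 1 3 M \<and>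
         (\<omega> 2 3 \<circ> \<phi> sigma23) M = \<omega> 2 3 M \<and>
         (\<omega> 1 3 \<circ> \<phi> sigma23) M = \<omega> 1 2 M"
proof -
  obtain A B C where M: "M = (A, B, C)" and A: "A \<in> SL2" and B: "B \<in> SL2" and C: "C \<in> SL2"
    using assms(3) by (auto simp: SL2_triples_def)
  have \<phi>12: "\<phi> sigma12 (A, B, C) = (A ** B ** matrix_inv A, A, C)"
    and \<phi>23: "\<phi> sigma23 (A, B, C) = (A, B ** C ** matrix_inv B, B)"
    using assms(2) A B C by simp_all
  \<comment> \<open>The product of the two entries that a generator moves is unchanged. This fixes
    \<open>G_pair 1 2\<close> and \<open>G_inf\<close> under \<open>sigma12\<close>, and
    \<open>G_pair 2 3\<close> under \<open>sigma23\<close>.\<close>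
  have conj_cancel: "X ** Y ** matrix_inv X ** X = X ** Y" if "X \<in> SL2" for X Y :: cmat2
    by (simp add: matrix_mul_assoc[symmetric] SL2_inv[OF that])
  \<comment> \<open>The same cancellation behind a left factor: \<open>G_inf\<close> is fixed by
    \<open>sigma23\<close>.\<close>
  have inf23: "A ** (B ** C ** matrix_inv B) ** B = A ** B ** C"
    by (simp add: matrix_mul_assoc[symmetric] SL2_inv[OF B])
  \<comment> \<open>Cyclicity moves the conjugate to the front, so that
    \<open>SL2_trace_conj_mult\<close> applies with \<open>B\<close>, \<open>C\<close>,
    \<open>A\<close> in the roles of \<open>A\<close>, \<open>B\<close>, \<open>C\<close>.\<close>
  have "trace (A ** (B ** C ** matrix_inv B)) = trace (B ** C ** matrix_inv B ** A)"
    by (rule trace_mul_sym)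
  also have "\<dots> = trace B * trace (A ** B ** C) + trace A * trace C
      - trace (B ** C) * trace (A ** B) - trace (A ** C)"
    using trace_mul_sym[of "B ** C" A] trace_mul_sym[of B A] trace_mul_sym[of C A]
    by (simp add: SL2_trace_conj_mult[OF B A] matrix_mul_assoc algebra_simps)
  finally have pair12: "trace (A ** (B ** C ** matrix_inv B)) = \<dots>" .
  \<comment> \<open>Each generator swaps two of the \<open>G_single\<close> by conjugation
    invariance and fixes \<open>G_inf\<close>, hence it merely permutes the
    \<open>\<omega>\<close>.\<close>
  show ?thesis
    unfolding M o_apply \<phi>12 \<phi>23
    by (simp add: G_pair_def G_single_def G_inf_def \<omega>_def conj_cancel A B inf23 pair12
        SL2_trace_conj SL2_trace_conj_mult[OF A C] algebra_simps)
qed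

end
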